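(* Let $0<r<1$ and $\lambda_0\in(0,1)$, and let $(\lambda_n)_{n\ge 0}$ be the real sequence defined by $\lambda_{n+1}=r\,\lambda_n(1-\lambda_n)$ for $n=0,1,2,\ldots$. Then $$\lim_{n\to\infty}\frac{\ln\lambda_n}{n}=\ln r.$$ *)

theory Defs imports Complex_Main begin

end

(* The reciprocals satisfy 1 / lam (n+1) = (1 / lam n + 1 / (1 - lam n)) / r, so u n = r^n / lam n
   increases by r^n / (1 - lam n), which is at most r^n / (1 - lam 0). Hence u stays between 1 and a
   constant, and ln (lam n) = n ln r - ln (u n) with ln (u n) bounded. *)
theory Submission imports Defs begin

text \<open>While \<open>lam n\<close> lies in (0, 1), so do both factors r and
  \<open>1 - lam n\<close>, hence the sequence stays positive and decreases. The bound by
  \<open>lam 0\<close>, rather than by 1, keeps \<open>1 - lam n\<close> away from 0 uniformly in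
  n.\<close>

lemma subcritical_logistic_bounds:
  fixes r :: real and lam :: "nat \<Rightarrow> real"
  assumes r: "0 < r" "r < 1"
    and lam0: "0 < lam 0" "lam 0 < 1"
    and step: "\<And>n. lam (Suc n) = r * lam n * (1 - lam n)"
  shows "0 < lam n" and "lam n \<le> lam 0"
proof -
  have "0 < lam n \<and> lam n \<le> lam 0"
  proof (induction n)
    case 0
    then show ?case using lam0 by simp
  next
    case (Suc n)
    then have pos: "0 < lam n" and lt: "lam n < 1" using lam0 by auto
    have "r * (1 - lam n) \<le> 1"
      using r pos lt by (intro mult_le_one) auto
    then have "lam n * (r * (1 - lam n)) \<le> lam n"
      using pos by (intro mult_left_le) auto
    then have "lam (Suc n) \<le> lam n" by (simp add: step mult_ac)
    moreover have "0 < lam (Suc n)" using r pos lt by (simp add: step)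
    ultimately show ?case using Suc.IH by simp
  qed
  then show "0 < lam n" "lam n \<le> lam 0" by auto
qed

text \<open>The quotient \<open>(1 - r ^ n) / (1 - r)\<close> is the geometric sum of
  \<open>r ^ k\<close> over k < n, which collects the increments up to n. Keeping
  \<open>r ^ n\<close> in the bound lets the induction close exactly; a bound constant in n would
  not be inductive.\<close>

lemma subcritical_logistic_ratio_bounds:
  fixes r :: real and lam :: "nat \<Rightarrow> real"
  assumes r: "0 < r" "r < 1"
    and lam0: "0 < lam 0" "lam 0 < 1"
    and step: "\<And>n. lam (Suc n) = r * lam n * (1 - lam n)"
  shows "1 \<le> r ^ n / lam n"
    and "r ^ n / lam n \<le> 1 / lam 0 + (1 - r ^ n) / ((1 - lam 0) * (1 - r))"
proof -
  note bounds = subcritical_logistic_bounds[OF assms]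
  \<comment> \<open>Partial fractions: 1 / (x (1 - x)) = 1 / x + 1 / (1 - x) at x =
    \<open>lam n\<close>; the factor r from \<open>step\<close> cancels one power of r.\<close>
  have incr: "r ^ Suc n / lam (Suc n) = r ^ n / lam n + r ^ n / (1 - lam n)" for n
    using bounds[of n] lam0 r by (simp add: step field_simps)
  have incr_le: "r ^ n / (1 - lam n) \<le> r ^ n / (1 - lam 0)" for n
    using bounds[of n] lam0 r by (intro divide_left_mono) auto
  show "1 \<le> r ^ n / lam n"
  proof (induction n)
    case 0
    then show ?case using lam0 by simp
  next
    case (Suc n)
    have "0 \<le> r ^ n / (1 - lam n)" using bounds[of n] lam0 r by simp
    then show ?case using Suc incr[of n] by linarith
  qed
  show "r ^ n / lam n \<le> 1 / lam 0 + (1 - r ^ n) / ((1 - lam 0) * (1 - r))"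
  proof (induction n)
    case 0
    then show ?case by simp
  next
    case (Suc n)
    \<comment> \<open>The geometric sum gains its next term \<open>r ^ n\<close>, scaled by
      \<open>1 / (1 - lam 0)\<close>.\<close>
    have "(1 - r ^ n) / ((1 - lam 0) * (1 - r)) + r ^ n / (1 - lam 0)
        = (1 - r ^ Suc n) / ((1 - lam 0) * (1 - r))"
      using r lam0 by (simp add: divide_simps) (simp add: algebra_simps)
    then show ?case using Suc incr[of n] incr_le[of n] by linarith
  qed
qed

theorem mainTheorem4:
  fixes r :: real and lam :: "nat \<Rightarrow> real"
  assumes "0 < r" and "r < 1"
    and "0 < lam 0" and "lam 0 < 1"
    and "\<And>n. lam (Suc n) = r * lam n * (1 - lam n)"
  shows "(\<lambda>n. ln (lam n) / real n) \<longlonglongrightarrow> ln r"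
proof -
  define u where "u n = r ^ n / lam n" for n
  \<comment> \<open>The full geometric series replaces the partial sum, so C does not depend on
    n.\<close>
  define C where "C = 1 / lam 0 + 1 / ((1 - lam 0) * (1 - r))"
  note pos = subcritical_logistic_bounds(1)[OF assms]
  have u_ge: "1 \<le> u n" for n
    unfolding u_def by (rule subcritical_logistic_ratio_bounds(1)[OF assms])
  have u_le: "u n \<le> C" for n
  proof -
    have "(1 - r ^ n) / ((1 - lam 0) * (1 - r)) \<le> 1 / ((1 - lam 0) * (1 - r))"
      using assms by (intro divide_right_mono) auto
    then show ?thesis
      using subcritical_logistic_ratio_bounds(2)[OF assms, of n] unfolding u_def C_def by linarith
  qed
  have ln_u: "0 \<le> ln (u n)" "ln (u n) \<le> ln C" for n
    using u_ge[of n] u_le[of n] by (auto intro: ln_mono)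
  have "(\<lambda>n. ln (u n) / real n) \<longlonglongrightarrow> 0"
  proof (rule tendsto_sandwich)
    show "\<forall>\<^sub>F n in sequentially. 0 \<le> ln (u n) / real n" using ln_u by simp
    show "\<forall>\<^sub>F n in sequentially. ln (u n) / real n \<le> ln C / real n"
      using ln_u by (simp add: divide_right_mono)
    show "(\<lambda>n. ln C / real n) \<longlonglongrightarrow> 0" by (rule lim_const_over_n)
  qed simp
  then have "(\<lambda>n. ln r - ln (u n) / real n) \<longlonglongrightarrow> ln r - 0"
    by (intro tendsto_diff tendsto_const)
  \<comment> \<open>The equality holds only for n > 0: at n = 0 division by zero gives 0, so the
    left side is ln r < 0 and the right side is 0.\<close>
  moreover have "\<forall>\<^sub>F n in sequentially. ln r - ln (u n) / real n = ln (lam n) / real n"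
    using eventually_gt_at_top[of 0]
  proof eventually_elim
    case (elim n)
    have "ln (u n) = real n * ln r - ln (lam n)"
      unfolding u_def using pos[of n] assms(1) by (simp add: ln_div ln_realpow)
    then show ?case using elim by (simp add: field_simps)
  qed
  ultimately show ?thesis by (auto elim: Lim_transform_eventually)
qed

end
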